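(* Let $\frac12<q<p\le 1$. For every $\varepsilon>0$ there exists $n_0$ (depending only on $p$, $q$, $\varepsilon$) such that for every integer $N>n_0$ and every environment $\omega:\{1,\dots,N-1\}\to\{p,q\}$, $$\frac{E_\omega^0(T_N)}{N}>\frac{E_{\omega_{N,k}}^0(T_N)}{N}-\varepsilon,$$ where $k=\#\{i\in\{1,\dots,N-1\}:\omega(i)=p\}$ is the number of $p$-drifts in $\omega$.
   Context: The walk in environment $\omega$ with reflection at the origin is the Markov chain $\{X_n\}_{n\ge0}$ on $\{0,1,\dots,N\}$ with $P(X_{n+1}=i+1\mid X_n=i)=\omega(i)$ and $P(X_{n+1}=i-1\mid X_n=i)=1-\omega(i)$ for $1\le i\le N-1$, and $P(X_{n+1}=1\mid X_n=0)=1$ (the behavior after reaching $N$ is irrelevant). $T_N=\min\{n\ge0\mid X_n=N\}$, and $E_\omega^0$ denotes expectation for the walk in environment $\omega$ started at $X_0=0$. A vertex $i$ with $\omega(i)=p$ is called a $p$-drift. For $0\le k\le N-1$, the equally spaced environment $\omega_{N,k}$ on $\{1,\dots,N-1\}$ is $$\omega_{N,k}(x)=\begin{cases}p & x=\left\lfloor i\cdot\frac{N-1}{k}\right\rfloor\text{ for some integer }1\le i\le k,\\ q&\text{otherwise}\end{cases}$$ (for $k=0$ it is identically $q$). *)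

theory Defs
  imports "HOL-Probability.Probability"
begin

text \<open>
  An environment assigns to each interior vertex the probability of a step to the right.
  Only its values on \<open>{1..N-1}\<close> are used; vertices from \<open>N\<close> on are made absorbing, which
  does not affect the hitting time of \<open>N\<close>.
\<close>

definition walk_step :: "nat \<Rightarrow> (nat \<Rightarrow> real) \<Rightarrow> nat \<Rightarrow> nat pmf" where
  "walk_step N \<omega> i =
    (if i = 0 then return_pmf 1
     else if i < N then map_pmf (\<lambda>right. if right then i + 1 else i - 1) (bernoulli_pmf (\<omega> i))
     else return_pmf i)"

lemma pmf_walk_step_0: "pmf (walk_step N \<omega> 0) 1 = 1"
  by (simp add: walk_step_def)

lemma pmf_walk_step:
  assumes "1 \<le> i" "i < N" "0 \<le> \<omega> i" "\<omega> i \<le> 1"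
  shows "pmf (walk_step N \<omega> i) (i + 1) = \<omega> i"
    and "pmf (walk_step N \<omega> i) (i - 1) = 1 - \<omega> i"
proof -
  have "(\<lambda>right. if right then i + 1 else i - 1) -` {i + 1} = {True}"
       "(\<lambda>right. if right then i + 1 else i - 1) -` {i - 1} = {False}"
    using assms by (auto split: if_splits)
  with assms show "pmf (walk_step N \<omega> i) (i + 1) = \<omega> i"
    and "pmf (walk_step N \<omega> i) (i - 1) = 1 - \<omega> i"
    by (simp_all add: walk_step_def pmf_map measure_pmf_single)
qed

text \<open>Conditional law of \<open>X n\<close> given the earlier part \<open>X\<close> of the trajectory.\<close>

definition walk_kernel ::
    "nat \<Rightarrow> (nat \<Rightarrow> real) \<Rightarrow> nat \<Rightarrow> nat \<Rightarrow> (nat \<Rightarrow> nat) \<Rightarrow> nat measure" where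
  "walk_kernel N \<omega> x n X =
    (case n of 0 \<Rightarrow> measure_pmf (return_pmf x) | Suc m \<Rightarrow> measure_pmf (walk_step N \<omega> (X m)))"

lemma measurable_walk_kernel:
  "walk_kernel N \<omega> x n \<in>
    measurable (PiM {0..<n} (\<lambda>_. count_space UNIV)) (subprob_algebra (count_space UNIV))"
proof (cases n)
  case 0
  then show ?thesis
    by (simp add: walk_kernel_def [abs_def] measure_pmf_in_subprob_algebra)
next
  case (Suc m)
  have "(\<lambda>X. X m) \<in> measurable (PiM {0..<n} (\<lambda>_. count_space UNIV)) (count_space (UNIV :: nat set))"
    by (rule measurable_component_singleton) (simp add: Suc)
  moreover have "(\<lambda>i. measure_pmf (walk_step N \<omega> i)) \<in>
      measurable (count_space UNIV) (subprob_algebra (count_space UNIV))"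
    by (simp add: measure_pmf_in_subprob_algebra)
  ultimately show ?thesis
    unfolding walk_kernel_def [abs_def] Suc nat.case by (rule measurable_compose)
qed

lemma prob_space_walk_kernel: "prob_space (walk_kernel N \<omega> x n X)"
  by (cases n) (simp_all add: walk_kernel_def prob_space_measure_pmf)

global_interpretation walk: Ionescu_Tulcea "walk_kernel N \<omega> x" "\<lambda>_. count_space UNIV"
  for N \<omega> x
  by (rule Ionescu_Tulcea.intro) (rule measurable_walk_kernel, rule prob_space_walk_kernel)

text \<open>Law, on the space of trajectories, of the walk started at \<open>x\<close>.\<close>

definition walk_law :: "nat \<Rightarrow> (nat \<Rightarrow> real) \<Rightarrow> nat \<Rightarrow> (nat \<Rightarrow> nat) measure" where
  "walk_law N \<omega> x = walk.PF.lim N \<omega> x"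

lemma sets_walk_law: "sets (walk_law N \<omega> x) = sets (PiM UNIV (\<lambda>_. count_space UNIV))"
  by (simp add: walk_law_def)

lemma prob_space_walk_law: "prob_space (walk_law N \<omega> x)"
proof
  have "prob_space (walk.CI N \<omega> x {})"
    by (rule walk.PF.prob_space_P) auto
  then have "emeasure (walk.CI N \<omega> x {}) (space (PiM {} (\<lambda>_. count_space UNIV))) = 1"
    by (metis prob_space.emeasure_space_1 sets_eq_imp_space_eq walk.PF.sets_P subset_UNIV finite.emptyI)
  then have "emeasure (walk_law N \<omega> x) UNIV = 1"
    using walk.lim[OF finite.emptyI sets.top, of N \<omega> x]
    by (simp add: walk_law_def prod_emb_def space_PiM PiE_def extensional_def restrict_def)
  moreover have "space (walk_law N \<omega> x) = UNIV"
    using sets_eq_imp_space_eq[OF sets_walk_law] by (simp add: space_PiM PiE_def extensional_def)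
  ultimately show "emeasure (walk_law N \<omega> x) (space (walk_law N \<omega> x)) = 1"
    by simp
qed

lemma sets_cylinder:
  fixes n :: nat and f :: "nat \<Rightarrow> nat"
  shows "{restrict f {0..<n}} \<in> sets (PiM {0..<n} (\<lambda>_. count_space (UNIV :: nat set)))"
proof -
  have "{restrict f {0..<n}} = PiE {0..<n} (\<lambda>i. {f i})"
    by (auto simp: PiE_singleton restrict_def PiE_iff extensional_def)
  moreover have "PiE {0..<n} (\<lambda>i. {f i}) \<in> sets (PiM {0..<n} (\<lambda>_. count_space (UNIV :: nat set)))"
    by (rule sets_PiM_I_finite) auto
  ultimately show ?thesis
    by simp
qed

lemma emeasure_walk_law_cylinder:
  "emeasure (walk_law N \<omega> x) {X. \<forall>i<n. X i = f i} =
    emeasure (walk.C N \<omega> x 0 n (\<lambda>_. undefined)) {restrict f {0..<n}}"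
proof -
  let ?M = "\<lambda>_. count_space (UNIV :: nat set)"
  have "restrict X {0..<n} = restrict f {0..<n} \<longleftrightarrow> (\<forall>i<n. X i = f i)" for X
    unfolding fun_eq_iff restrict_def by auto
  then have "{X. \<forall>i<n. X i = f i} = prod_emb UNIV ?M {0..<n} {restrict f {0..<n}}"
    by (simp add: prod_emb_def space_PiM PiE_def extensional_def vimage_def)
  then have "emeasure (walk_law N \<omega> x) {X. \<forall>i<n. X i = f i} =
      emeasure (walk.CI N \<omega> x {0..<n}) {restrict f {0..<n}}"
    unfolding walk_law_def by (simp add: walk.lim sets_cylinder)
  also have "\<dots> = emeasure (walk.C N \<omega> x 0 n (\<lambda>_. undefined))
      (prod_emb {0..<n} ?M {0..<n} {restrict f {0..<n}})"
    by (rule walk.emeasure_CI) (auto simp: sets_cylinder)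
  also have "prod_emb {0..<n} ?M {0..<n} {restrict f {0..<n}} = {restrict f {0..<n}}"
    by (rule prod_emb_id) (auto simp: space_PiM)
  finally show ?thesis .
qed

lemma emeasure_walk_law_cylinder_Suc:
  "emeasure (walk_law N \<omega> x) {X. \<forall>i<Suc n. X i = f i} =
    emeasure (walk_law N \<omega> x) {X. \<forall>i<n. X i = f i} *
    emeasure (walk_kernel N \<omega> x n (restrict f {0..<n})) {f n}"
proof -
  let ?M = "\<lambda>_. count_space (UNIV :: nat set)"
  let ?f = "restrict f {0..<n}" and ?g = "restrict f {0..<Suc n}"
  let ?C = "walk.C N \<omega> x 0 n (\<lambda>_. undefined)"
  have u: "(\<lambda>_. undefined) \<in> space (PiM {0..<0} ?M)"
    by (simp add: space_PiM PiE_def extensional_def)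
  have sC: "sets ?C = sets (PiM {0..<n} ?M)"
    using walk.sets_C[OF u, of N \<omega> x n] by simp
  have spC: "space ?C = space (PiM {0..<n} ?M)"
    by (rule sets_eq_imp_space_eq[OF sC])
  have *: "emeasure (walk.eP N \<omega> x n y) {?g} =
      emeasure (walk_kernel N \<omega> x n ?f) {f n} * indicator {?f} y"
    if y: "y \<in> space (PiM {0..<n} ?M)" for y
  proof -
    have ext: "y i = undefined" if "\<not> i < n" for i
      using y that by (auto simp: space_PiM PiE_def extensional_def)
    have "y(n := z) = ?g \<longleftrightarrow> y = ?f \<and> z = f n" for z
    proof
      assume eq: "y(n := z) = ?g"
      have "y i = ?f i" for i
        using fun_cong[OF eq, of i] ext[of i] by (cases "i < n") (auto split: if_splits)
      with fun_cong[OF eq, of n] show "y = ?f \<and> z = f n"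
        by auto
    qed (auto simp: fun_eq_iff)
    then have "(\<lambda>z. y(n := z)) -` {?g} \<inter> space (?M n) = (if y = ?f then {f n} else {})"
      by auto
    then show ?thesis
      using walk.emeasure_eP[OF y sets_cylinder[of f "Suc n"], of N \<omega> x]
      by (auto simp: indicator_def)
  qed
  have "emeasure (walk_law N \<omega> x) {X. \<forall>i<Suc n. X i = f i} =
      emeasure (?C \<bind> walk.eP N \<omega> x n) {?g}"
    using emeasure_walk_law_cylinder[of N \<omega> x "Suc n" f] by simp
  also have "\<dots> = (\<integral>\<^sup>+ y. emeasure (walk.eP N \<omega> x n y) {?g} \<partial>?C)"
  proof (rule emeasure_bind)
    show "space ?C \<noteq> {}"
      using prob_space.not_empty[OF walk.prob_space_C[OF u]] .
    show "walk.eP N \<omega> x n \<in> measurable ?C (subprob_algebra (PiM {0..<Suc n} ?M))"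
      using walk.measurable_eP[of N \<omega> x n] by (simp add: measurable_cong_sets[OF sC refl])
    show "{?g} \<in> sets (PiM {0..<Suc n} ?M)"
      by (rule sets_cylinder)
  qed
  also have "\<dots> = (\<integral>\<^sup>+ y. emeasure (walk_kernel N \<omega> x n ?f) {f n} * indicator {?f} y \<partial>?C)"
    by (rule nn_integral_cong) (simp add: * spC)
  also have "\<dots> = emeasure (walk_kernel N \<omega> x n ?f) {f n} * emeasure ?C {?f}"
    by (rule nn_integral_cmult_indicator) (simp add: sC sets_cylinder)
  finally show ?thesis
    by (simp add: emeasure_walk_law_cylinder mult.commute)
qed

lemma walk_law_start: "emeasure (walk_law N \<omega> x) {X. X 0 = x} = 1"
proof -
  have "space (walk_law N \<omega> x) = UNIV"
    using sets_eq_imp_space_eq[OF sets_walk_law] by (simp add: space_PiM PiE_def extensional_def)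
  then have "emeasure (walk_law N \<omega> x) UNIV = 1"
    using prob_space.emeasure_space_1[OF prob_space_walk_law, of N \<omega> x] by simp
  then show ?thesis
    using emeasure_walk_law_cylinder_Suc[of N \<omega> x 0 "\<lambda>_. x"]
    by (simp add: walk_kernel_def)
qed

lemma walk_law_transition:
  "emeasure (walk_law N \<omega> x) {X. \<forall>i\<le>Suc n. X i = f i} =
    emeasure (walk_law N \<omega> x) {X. \<forall>i\<le>n. X i = f i} *
    ennreal (pmf (walk_step N \<omega> (f n)) (f (Suc n)))"
  using emeasure_walk_law_cylinder_Suc[of N \<omega> x "Suc n" f]
  by (simp add: walk_kernel_def emeasure_pmf_single less_Suc_eq_le)

definition hitting_time :: "nat \<Rightarrow> (nat \<Rightarrow> nat) \<Rightarrow> ennreal" where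
  "hitting_time N X = (if \<exists>n. X n = N then of_nat (LEAST n. X n = N) else \<infinity>)"

lemma measurable_hitting_time [measurable]:
  "hitting_time N \<in> borel_measurable (PiM UNIV (\<lambda>_. count_space UNIV))"
  unfolding hitting_time_def [abs_def] by measurable

definition expected_hitting_time :: "nat \<Rightarrow> (nat \<Rightarrow> real) \<Rightarrow> nat \<Rightarrow> ereal" where
  "expected_hitting_time N \<omega> x = enn2ereal (\<integral>\<^sup>+ X. hitting_time N X \<partial>walk_law N \<omega> x)"

definition equally_spaced_env :: "real \<Rightarrow> real \<Rightarrow> nat \<Rightarrow> nat \<Rightarrow> nat \<Rightarrow> real" where
  "equally_spaced_env p q N k x =
    (if \<exists>i\<in>{1..k}. int x = \<lfloor>real i * ((real N - 1) / real k)\<rfloor> then p else q)"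

end

theory Submission
  imports Defs "HOL-Real_Asymp.Real_Asymp"
begin

text \<open>
  With \<open>\<rho> x = (1 - \<omega> x) / \<omega> x\<close>, the expected hitting time is \<open>N\<close> plus twice the sum, over all
  intervals of interior vertices, of the product of \<open>\<rho>\<close> over the interval. Grouping the intervals
  (windows) by length \<open>m\<close>, a window containing \<open>c\<close> drifts contributes \<open>b ^ m * r ^ c\<close>, where
  \<open>b < 1\<close> is the value of \<open>\<rho>\<close> at a \<open>q\<close>-vertex and \<open>r \<le> 1\<close>. The number of drifts, summed over
  the windows of length \<open>m\<close>, is \<open>m * k\<close> up to a boundary error of at most \<open>2 * m\<^sup>2\<close>. Since
  \<open>c \<mapsto> r ^ c\<close> is convex, the sum over these windows is smallest when all the counts are equal to
  \<open>f\<close> or \<open>f + 1\<close>, as they are for equal spacing. The total error is at most the convergent sum of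
  \<open>2 * m\<^sup>2 * b ^ m\<close>, so equal spacing exceeds the
  minimal expected hitting time by a bounded amount only.
\<close>

section \<open>Tail sum of the hitting time, and the Markov property\<close>

lemma space_walk_law: "space (walk_law N \<omega> x) = UNIV"
  using sets_eq_imp_space_eq[OF sets_walk_law] by (simp add: space_PiM PiE_def extensional_def)

lemma measurable_walk_law_coordinate [measurable]:
  "(\<lambda>X. X i) \<in> measurable (walk_law N \<omega> x) (count_space UNIV)"
  by (simp add: measurable_cong_sets[OF sets_walk_law refl] measurable_component_singleton)

text \<open>Every time before the first visit to \<open>N\<close> contributes 1; without a visit the
  sum diverges, in agreement with the value infinity. Integrating term by term then reduces the
  expectation to survival probabilities.\<close>

lemma hitting_time_eq_suminf:
  "hitting_time N X = (\<Sum>n. indicator {X. \<forall>m\<le>n. X m \<noteq> N} X)"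
proof (cases "\<exists>n. X n = N")
  case True
  define L where "L = (LEAST n. X n = N)"
  have "(\<forall>m\<le>n. X m \<noteq> N) \<longleftrightarrow> n < L" for n
    using True LeastI_ex[OF True] not_less_Least[of _ "\<lambda>n. X n = N"]
    unfolding L_def by (metis le_less_trans not_le_imp_less)
  then have "(\<Sum>n. indicator {X. \<forall>m\<le>n. X m \<noteq> N} X :: ennreal) = (\<Sum>n. if n < L then 1 else 0)"
    by (intro suminf_cong) (simp add: indicator_def)
  also have "\<dots> = (\<Sum>n<L. if n < L then 1 else 0)"
    by (rule suminf_finite) auto
  finally show ?thesis
    using True by (simp add: hitting_time_def L_def)
next
  case False
  have "(\<Sum>n. 1 :: ennreal) = \<infinity>"
    using nn_integral_count_space_nat[of "\<lambda>_. 1"] by simp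
  with False show ?thesis
    by (simp add: hitting_time_def)
qed

text \<open>An event determined by the coordinates up to \<open>n\<close> is a countable disjoint
  union of cylinders, coded by lists of length \<open>Suc n\<close>.
  \<open>walk_law_transition\<close> applies to each cylinder, and as all of them end in
  \<open>j\<close>, the same factor comes out of the sum.\<close>

lemma emeasure_walk_law_markov:
  assumes Q: "\<And>X Y. (\<And>i. i \<le> n \<Longrightarrow> X i = Y i) \<Longrightarrow> Q X \<Longrightarrow> Q Y"
  shows "emeasure (walk_law N \<omega> x) {X. Q X \<and> X n = j \<and> X (Suc n) = i} =
    emeasure (walk_law N \<omega> x) {X. Q X \<and> X n = j} * ennreal (pmf (walk_step N \<omega> j) i)"
proof -
  define I where "I = {xs :: nat list. length xs = Suc n \<and> xs ! n = j \<and> Q (\<lambda>i. xs ! i)}"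
  define C where "C xs = {X. \<forall>i\<le>n. X i = xs ! i}" for xs :: "nat list"
  define D where "D xs = {X. \<forall>l\<le>Suc n. X l = (xs @ [i]) ! l}" for xs :: "nat list"
  have idx: "map X [0..<Suc n] \<in> I \<and> X \<in> C (map X [0..<Suc n])" if "Q X" "X n = j" for X
    using that Q[of X "\<lambda>i. map X [0..<Suc n] ! i"]
    by (auto simp: I_def C_def nth_append simp del: upt_Suc)
  have CQ: "Q X \<and> X n = j" if "xs \<in> I" "X \<in> C xs" for xs X
    using that Q[of "\<lambda>i. xs ! i" X] by (auto simp: I_def C_def)
  have DC: "D xs = C xs \<inter> {X. X (Suc n) = i}" if "xs \<in> I" for xs
    using that by (auto simp: I_def C_def D_def nth_append le_Suc_eq)
  have eqC: "{X. Q X \<and> X n = j} = (\<Union>xs\<in>I. C xs)"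
    using idx CQ by blast
  have eqD: "{X. Q X \<and> X n = j \<and> X (Suc n) = i} = (\<Union>xs\<in>I. D xs)"
    using idx CQ DC by blast
  have disj: "disjoint_family_on C I"
    unfolding disjoint_family_on_def
  proof (intro ballI impI)
    fix xs ys assume xy: "xs \<in> I" "ys \<in> I" "xs \<noteq> ys"
    then obtain l where "l \<le> n" "xs ! l \<noteq> ys ! l"
      unfolding I_def by (metis (mono_tags, lifting) less_Suc_eq_le list_eq_iff_nth_eq mem_Collect_eq)
    then show "C xs \<inter> C ys = {}"
      by (auto simp: C_def)
  qed
  have disjD: "disjoint_family_on D I"
    using disj DC unfolding disjoint_family_on_def by blast
  have sets: "{X. \<forall>i\<le>l. X i = xs ! i} \<in> sets (walk_law N \<omega> x)" for xs :: "nat list" and l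
  proof -
    have "{X\<in>space (walk_law N \<omega> x). \<forall>i\<le>l. X i = xs ! i} \<in> sets (walk_law N \<omega> x)"
      by measurable
    then show ?thesis by (simp add: space_walk_law)
  qed
  have step: "emeasure (walk_law N \<omega> x) (D xs) =
      emeasure (walk_law N \<omega> x) (C xs) * ennreal (pmf (walk_step N \<omega> j) i)" if "xs \<in> I" for xs
  proof -
    have "{X. \<forall>l\<le>n. X l = (xs @ [i]) ! l} = C xs"
      using that by (auto simp: I_def C_def nth_append)
    then show ?thesis
      using walk_law_transition[of N \<omega> x n "\<lambda>l. (xs @ [i]) ! l"] that
      by (simp add: D_def I_def nth_append)
  qed
  have "emeasure (walk_law N \<omega> x) (\<Union>xs\<in>I. D xs) =
      (\<integral>\<^sup>+ xs. emeasure (walk_law N \<omega> x) (D xs) \<partial>count_space I)"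
    by (rule emeasure_UN_countable) (use disjD in \<open>auto simp: D_def [abs_def] sets\<close>)
  also have "\<dots> = (\<integral>\<^sup>+ xs. emeasure (walk_law N \<omega> x) (C xs) * ennreal (pmf (walk_step N \<omega> j) i) \<partial>count_space I)"
    by (rule nn_integral_cong) (simp add: step)
  also have "\<dots> = (\<integral>\<^sup>+ xs. emeasure (walk_law N \<omega> x) (C xs) \<partial>count_space I) * ennreal (pmf (walk_step N \<omega> j) i)"
    by (rule nn_integral_multc) simp
  also have "(\<integral>\<^sup>+ xs. emeasure (walk_law N \<omega> x) (C xs) \<partial>count_space I) =
      emeasure (walk_law N \<omega> x) (\<Union>xs\<in>I. C xs)"
    by (rule emeasure_UN_countable[symmetric]) (use disj in \<open>auto simp: C_def [abs_def] sets\<close>)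
  finally show ?thesis
    by (simp only: eqC eqD)
qed

section \<open>The law of the walk killed on reaching \<open>N\<close>\<close>

definition alive_at :: "nat \<Rightarrow> (nat \<Rightarrow> real) \<Rightarrow> nat \<Rightarrow> nat \<Rightarrow> ennreal" where
  "alive_at N \<omega> n i = emeasure (walk_law N \<omega> 0) {X. (\<forall>m\<le>n. X m \<noteq> N) \<and> X n = i}"

lemma sets_alive:
  "{X. (\<forall>m\<le>n. X m \<noteq> N) \<and> X l = i} \<in> sets (walk_law N' \<omega> x)"
  "{X. (\<forall>m\<le>n. X m \<noteq> N)} \<in> sets (walk_law N' \<omega> x)"
proof -
  have "{X\<in>space (walk_law N' \<omega> x). (\<forall>m\<le>n. X m \<noteq> N) \<and> X l = i} \<in> sets (walk_law N' \<omega> x)"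
    "{X\<in>space (walk_law N' \<omega> x). (\<forall>m\<le>n. X m \<noteq> N)} \<in> sets (walk_law N' \<omega> x)"
    by measurable
  then show "{X. (\<forall>m\<le>n. X m \<noteq> N) \<and> X l = i} \<in> sets (walk_law N' \<omega> x)"
    "{X. (\<forall>m\<le>n. X m \<noteq> N)} \<in> sets (walk_law N' \<omega> x)"
    by (simp_all add: space_walk_law)
qed

lemma alive_at_0:
  assumes "N > 0"
  shows "alive_at N \<omega> 0 i = (if i = 0 then 1 else 0)"
proof (cases "i = 0")
  case True
  have "{X. (\<forall>m\<le>0. X m \<noteq> N) \<and> X 0 = 0} = {X. X (0::nat) = (0::nat)}"
    using assms by auto
  with True show ?thesis by (simp only: alive_at_def walk_law_start) simp
next
  case False
  interpret prob_space "walk_law N \<omega> 0" by (rule prob_space_walk_law)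
  have s: "{X. X 0 = 0} \<in> events"
  proof -
    have "{X\<in>space (walk_law N \<omega> 0). X 0 = 0} \<in> events" by measurable
    then show ?thesis by (simp add: space_walk_law)
  qed
  have "emeasure (walk_law N \<omega> 0) (space (walk_law N \<omega> 0) - {X. X 0 = 0}) = 0"
    using emeasure_compl[OF s] emeasure_space_1 by (simp add: walk_law_start)
  then have "emeasure (walk_law N \<omega> 0) {X. (\<forall>m\<le>0. X m \<noteq> N) \<and> X 0 = i} = 0"
    using False s
    by (auto simp: space_walk_law intro: emeasure_eq_0[of "space (walk_law N \<omega> 0) - {X. X 0 = 0}"])
  with False show ?thesis by (simp add: alive_at_def)
qed

lemma alive_at_target: "alive_at N \<omega> n N = 0"
proof -
  have "{X. (\<forall>m\<le>n. X m \<noteq> N) \<and> X n = N} = {}" by auto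
  then show ?thesis by (simp only: alive_at_def emeasure_empty)
qed

text \<open>Chapman-Kolmogorov for the killed walk: for \<open>i\<close> other than
  \<open>N\<close>, being alive in \<open>i\<close> at time \<open>Suc n\<close> means being alive
  at time \<open>n\<close> and stepping to \<open>i\<close>. The event is split by the position at
  time \<open>n\<close>.\<close>

lemma alive_at_Suc:
  assumes "i \<noteq> N"
  shows "alive_at N \<omega> (Suc n) i =
    (\<integral>\<^sup>+ j. alive_at N \<omega> n j * ennreal (pmf (walk_step N \<omega> j) i) \<partial>count_space UNIV)"
proof -
  let ?B = "\<lambda>j. {X. (\<forall>m\<le>n. X m \<noteq> N) \<and> X n = j \<and> X (Suc n) = i}"
  have B: "?B j \<in> sets (walk_law N \<omega> 0)" for j
  proof -
    have "{X\<in>space (walk_law N \<omega> 0). (\<forall>m\<le>n. X m \<noteq> N) \<and> X n = j \<and> X (Suc n) = i} \<in> sets (walk_law N \<omega> 0)"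
      by measurable
    then show ?thesis by (simp add: space_walk_law)
  qed
  have "{X. (\<forall>m\<le>Suc n. X m \<noteq> N) \<and> X (Suc n) = i} = (\<Union>j. ?B j)"
    using assms by (auto simp: le_Suc_eq)
  then have "alive_at N \<omega> (Suc n) i = emeasure (walk_law N \<omega> 0) (\<Union>j. ?B j)"
    by (simp only: alive_at_def)
  also have "\<dots> = (\<integral>\<^sup>+ j. emeasure (walk_law N \<omega> 0) (?B j) \<partial>count_space UNIV)"
    by (rule emeasure_UN_countable) (use B in \<open>auto simp: disjoint_family_on_def\<close>)
  also have "\<dots> = (\<integral>\<^sup>+ j. alive_at N \<omega> n j * ennreal (pmf (walk_step N \<omega> j) i) \<partial>count_space UNIV)"
    unfolding alive_at_def by (intro nn_integral_cong emeasure_walk_law_markov) auto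
  finally show ?thesis .
qed

lemma pmf_walk_step_eq_0:
  assumes "j < N" "i > N"
  shows "pmf (walk_step N \<omega> j) i = 0"
  using assms by (auto simp: walk_step_def pmf_eq_0_set_pmf split: if_splits)

text \<open>Steps to the right have length one, so a state beyond \<open>N\<close> can only be
  entered from \<open>N\<close> or from beyond; mass at \<open>N\<close> is killed. This makes all
  sums over states finite.\<close>

lemma alive_at_beyond:
  assumes "N > 0" "i \<ge> N"
  shows "alive_at N \<omega> n i = 0"
proof (cases "i = N")
  case False
  with assms have "i > N" by simp
  then show ?thesis
  proof (induction n arbitrary: i)
    case 0
    then show ?case using assms by (simp add: alive_at_0)
  next
    case (Suc n)
    have "alive_at N \<omega> n j * ennreal (pmf (walk_step N \<omega> j) i) = 0" for j
      using Suc pmf_walk_step_eq_0[of j N i \<omega>] alive_at_target[of N \<omega> n]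
      by (cases j N rule: linorder_cases) simp_all
    moreover have "i \<noteq> N" using Suc.prems by simp
    ultimately show ?case
      using alive_at_Suc[OF \<open>i \<noteq> N\<close>, of \<omega> n] by (simp only: nn_integral_const mult_zero_left)
  qed
qed (simp add: alive_at_target)

lemma emeasure_alive:
  assumes "N > 0"
  shows "emeasure (walk_law N \<omega> 0) {X. \<forall>m\<le>n. X m \<noteq> N} = (\<Sum>i<N. alive_at N \<omega> n i)"
proof -
  have "{X. \<forall>m\<le>n. X m \<noteq> N} = (\<Union>i. {X. (\<forall>m\<le>n. X m \<noteq> N) \<and> X n = i})"
    by auto
  then have "emeasure (walk_law N \<omega> 0) {X. \<forall>m\<le>n. X m \<noteq> N} =
      emeasure (walk_law N \<omega> 0) (\<Union>i. {X. (\<forall>m\<le>n. X m \<noteq> N) \<and> X n = i})"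
    by (simp only:)
  also have "\<dots> = (\<integral>\<^sup>+ i. alive_at N \<omega> n i \<partial>count_space UNIV)"
    unfolding alive_at_def
    by (rule emeasure_UN_countable) (use sets_alive in \<open>auto simp: disjoint_family_on_def\<close>)
  also have "\<dots> = (\<Sum>i<N. alive_at N \<omega> n i)"
    using assms alive_at_beyond[of N] by (intro nn_integral_count_space') auto
  finally show ?thesis .
qed

section \<open>The expected hitting time as a sum of crossing times\<close>

text \<open>The time \<open>\<tau> i\<close> to get from \<open>i\<close> to \<open>i + 1\<close>: conditioning on the first step gives
  \<open>\<tau> (i + 1) = 1 + (1 - \<omega> (i + 1)) * (\<tau> i + \<tau> (i + 1))\<close>, solved here for \<open>\<tau> (i + 1)\<close>.\<close>

primrec crossing_time :: "(nat \<Rightarrow> real) \<Rightarrow> nat \<Rightarrow> real" where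
  "crossing_time \<omega> 0 = 1"
| "crossing_time \<omega> (Suc i) = 1 / \<omega> (Suc i) + (1 - \<omega> (Suc i)) / \<omega> (Suc i) * crossing_time \<omega> i"

lemma crossing_time_ge_1:
  assumes "\<And>i. 1 \<le> i \<Longrightarrow> i \<le> l \<Longrightarrow> 0 < \<omega> i \<and> \<omega> i \<le> 1"
  shows "crossing_time \<omega> l \<ge> 1"
  using assms
proof (induction l)
  case (Suc l)
  have w: "0 < \<omega> (Suc l)" "\<omega> (Suc l) \<le> 1"
    using Suc.prems[of "Suc l"] by auto
  have "1 \<le> 1 / \<omega> (Suc l)" using w by simp
  moreover have "0 \<le> (1 - \<omega> (Suc l)) / \<omega> (Suc l) * crossing_time \<omega> l"
  proof (intro mult_nonneg_nonneg divide_nonneg_nonneg)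
    show "0 \<le> crossing_time \<omega> l"
      using Suc.IH Suc.prems by fastforce
  qed (use w in auto)
  ultimately show ?case by simp
qed simp

text \<open>\<open>h i\<close> is the candidate for the expected time from \<open>i\<close> to
  \<open>N\<close>. The recursion for \<open>crossing_time\<close> is exactly what makes one step
  lower its mean by 1.\<close>

lemma sum_pmf_walk_step_remaining_time:
  fixes N :: nat and \<omega> :: "nat \<Rightarrow> real"
  defines "h \<equiv> \<lambda>i. \<Sum>l=i..<N. crossing_time \<omega> l"
  assumes j: "j < N" and w: "\<And>i. 1 \<le> i \<Longrightarrow> i < N \<Longrightarrow> 0 < \<omega> i \<and> \<omega> i \<le> 1"
  shows "(\<Sum>i<N. pmf (walk_step N \<omega> j) i * h i) = h j - 1"
proof -
  have h_step: "h i = crossing_time \<omega> i + h (Suc i)" if "i < N" for i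
    using that by (simp add: h_def sum.atLeast_Suc_lessThan)
  have "set_pmf (walk_step N \<omega> j) \<subseteq> {..N}"
    using j by (auto simp: walk_step_def split: if_splits)
  then have "measure_pmf.expectation (walk_step N \<omega> j) h = (\<Sum>i\<le>N. pmf (walk_step N \<omega> j) i * h i)"
    by (subst integral_measure_pmf[of "{..N}"]) (auto simp: set_pmf_eq)
  \<comment> \<open>The term at \<open>N\<close> disappears because \<open>h N\<close> is an empty
    sum.\<close>
  also have "\<dots> = (\<Sum>i<N. pmf (walk_step N \<omega> j) i * h i)"
    by (simp add: lessThan_Suc_atMost[symmetric] h_def)
  finally have E: "(\<Sum>i<N. pmf (walk_step N \<omega> j) i * h i) = measure_pmf.expectation (walk_step N \<omega> j) h"
    by simp
  show ?thesis
  proof (cases j)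
    case 0
    then show ?thesis using h_step[of 0] j unfolding E by (simp add: walk_step_def)
  next
    case (Suc i)
    have wj: "0 < \<omega> j" "\<omega> j \<le> 1" using w[of j] j Suc by auto
    have "measure_pmf.expectation (walk_step N \<omega> j) h = \<omega> j * h (Suc j) + (1 - \<omega> j) * h i"
      using j wj Suc by (simp add: walk_step_def)
    also have "h (Suc j) = h j - crossing_time \<omega> j" using h_step[of j] j by simp
    also have "h i = h j + crossing_time \<omega> i" using h_step[of i] j Suc by simp
    also have "\<omega> j * (h j - crossing_time \<omega> j) + (1 - \<omega> j) * (h j + crossing_time \<omega> i) = h j - 1"
      using wj by (simp add: Suc field_simps)
    finally show ?thesis by (simp add: E)
  qed
qed

text \<open>Each step lowers \<open>V\<close> by the survival probability \<open>A n\<close>. The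
  sum of the survival probabilities, which is the expected hitting time, therefore telescopes to
  \<open>h 0\<close> once \<open>V\<close> is known to tend to 0.\<close>

lemma expected_hitting_time_eq_sum_crossing_time:
  assumes N: "N > 0" and w: "\<And>i. 1 \<le> i \<Longrightarrow> i < N \<Longrightarrow> 0 < \<omega> i \<and> \<omega> i \<le> 1"
  shows "expected_hitting_time N \<omega> 0 = ereal (\<Sum>l<N. crossing_time \<omega> l)"
proof -
  interpret prob_space "walk_law N \<omega> 0" by (rule prob_space_walk_law)
  \<comment> \<open>A real-valued copy of \<open>alive_at\<close>, so that the telescoping can
    subtract; no value is lost, the measures being finite.\<close>
  define s where "s n i = enn2real (alive_at N \<omega> n i)" for n i
  have s_nonneg: "0 \<le> s n i" for n i by (simp add: s_def)
  have s: "alive_at N \<omega> n i = ennreal (s n i)" for n i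
    by (simp add: s_def alive_at_def emeasure_eq_measure)
  define h where "h i = (\<Sum>l=i..<N. crossing_time \<omega> l)" for i
  have ct: "crossing_time \<omega> l \<ge> 0" if "l < N" for l
    using crossing_time_ge_1[of l \<omega>] w that by fastforce
  have h_nonneg: "0 \<le> h i" for i unfolding h_def by (rule sum_nonneg) (simp add: ct)
  have h_le: "h i \<le> h 0" for i
    unfolding h_def by (rule sum_mono2) (auto intro: ct)
  define A where "A n = (\<Sum>i<N. s n i)" for n
  text \<open>\<open>V n\<close> is the expected remaining time on the event that \<open>N\<close> is not hit up to time \<open>n\<close>.\<close>
  define V where "V n = (\<Sum>i<N. s n i * h i)" for n
  have s_Suc: "s (Suc n) i = (\<Sum>j<N. s n j * pmf (walk_step N \<omega> j) i)" if "i < N" for n i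
  proof -
    have "ennreal (s (Suc n) i) = (\<integral>\<^sup>+ j. alive_at N \<omega> n j * ennreal (pmf (walk_step N \<omega> j) i) \<partial>count_space UNIV)"
      using that by (simp add: s[symmetric] alive_at_Suc)
    also have "\<dots> = (\<Sum>j<N. alive_at N \<omega> n j * ennreal (pmf (walk_step N \<omega> j) i))"
      using N alive_at_beyond[of N] by (intro nn_integral_count_space') auto
    also have "\<dots> = ennreal (\<Sum>j<N. s n j * pmf (walk_step N \<omega> j) i)"
      by (simp add: s s_nonneg ennreal_mult'[symmetric] sum_ennreal)
    finally show ?thesis
      by (simp add: s_nonneg sum_nonneg)
  qed
  have V_Suc: "V (Suc n) = V n - A n" for n
  proof -
    have "V (Suc n) = (\<Sum>i<N. \<Sum>j<N. s n j * pmf (walk_step N \<omega> j) i * h i)"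
      by (simp add: V_def s_Suc sum_distrib_right)
    also have "\<dots> = (\<Sum>j<N. s n j * (\<Sum>i<N. pmf (walk_step N \<omega> j) i * h i))"
      by (subst sum.swap) (simp add: sum_distrib_left mult.assoc)
    also have "\<dots> = (\<Sum>j<N. s n j * (h j - 1))"
      unfolding h_def by (intro sum.cong refl) (subst sum_pmf_walk_step_remaining_time, use w in auto)
    finally show ?thesis
      by (simp add: V_def A_def algebra_simps sum_subtractf)
  qed
  have "s 0 i = (if i = 0 then 1 else 0)" for i
    using N by (simp add: s_def alive_at_0)
  then have V_0: "V 0 = h 0"
    using N by (simp add: V_def if_distrib[of "\<lambda>x. x * _"] cong: if_cong)
  have sum_A: "(\<Sum>n<M. A n) = h 0 - V M" for M
    by (induction M) (simp_all add: V_0 V_Suc)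
  have V_nonneg: "0 \<le> V n" for n
    unfolding V_def by (intro sum_nonneg mult_nonneg_nonneg s_nonneg h_nonneg)
  have A_nonneg: "0 \<le> A n" for n
    unfolding A_def by (intro sum_nonneg s_nonneg)
  \<comment> \<open>The partial sums are \<open>h 0 - V M\<close>, hence at most \<open>h 0\<close>.
    So \<open>A\<close> tends to 0, and with it \<open>V\<close>, since no remaining time exceeds
    \<open>h 0\<close>.\<close>
  have "summable A"
    using V_nonneg by (intro summableI_nonneg_bounded[where x = "h 0"]) (auto simp: A_nonneg sum_A)
  then have "A \<longlonglongrightarrow> 0" by (rule summable_LIMSEQ_zero)
  then have lim: "(\<lambda>n. A n * h 0) \<longlonglongrightarrow> 0"
    by (rule tendsto_mult_left_zero)
  have "V n \<le> A n * h 0" for n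
    unfolding V_def A_def sum_distrib_right by (intro sum_mono mult_left_mono h_le s_nonneg)
  then have "V \<longlonglongrightarrow> 0"
    by (intro tendsto_sandwich[OF _ _ tendsto_const lim]) (auto simp: V_nonneg)
  then have "(\<lambda>M. h 0 - V M) \<longlonglongrightarrow> h 0 - 0"
    by (intro tendsto_intros)
  then have sums: "A sums h 0"
    by (simp add: sums_def sum_A)
  have "(\<integral>\<^sup>+ X. hitting_time N X \<partial>walk_law N \<omega> 0) =
      (\<integral>\<^sup>+ X. (\<Sum>n. indicator {X. \<forall>m\<le>n. X m \<noteq> N} X) \<partial>walk_law N \<omega> 0)"
    by (simp only: hitting_time_eq_suminf)
  also have "\<dots> = (\<Sum>n. \<integral>\<^sup>+ X. indicator {X. \<forall>m\<le>n. X m \<noteq> N} X \<partial>walk_law N \<omega> 0)"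
    by (rule nn_integral_suminf) (use sets_alive in simp)
  also have "\<dots> = (\<Sum>n. \<Sum>i<N. alive_at N \<omega> n i)"
    by (simp only: nn_integral_indicator sets_alive emeasure_alive[OF N])
  also have "\<dots> = (\<Sum>n. ennreal (A n))"
    by (simp add: s s_nonneg sum_ennreal A_def)
  also have "\<dots> = ennreal (h 0)"
    using sums A_nonneg by (simp add: suminf_ennreal2 sums_iff)
  finally show ?thesis
    using h_nonneg[of 0] by (simp add: expected_hitting_time_def enn2ereal_ennreal h_def atLeast0LessThan)
qed


section \<open>Convexity, and double counting of drifts in windows\<close>

text \<open>The line through the points of the convex sequence \<open>r ^ c\<close> at
  \<open>f\<close> and \<open>Suc f\<close> stays below the sequence. To the right of
  \<open>f\<close> this is Bernoulli's inequality. Working without derivatives or division covers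
  \<open>r = 0\<close>, the case \<open>p = 1\<close>.\<close>

lemma power_ge_supporting_line:
  fixes r :: real
  assumes "0 \<le> r" "r \<le> 1"
  shows "r ^ f - (r ^ f - r ^ Suc f) * (real c - real f) \<le> r ^ c"
proof (cases "f \<le> c")
  case True
  then obtain d where c: "c = f + d" using le_Suc_ex by blast
  have "1 + real d * (r - 1) \<le> r ^ d"
    using Bernoulli_inequality[of "r - 1" d] assms by simp
  then have "r ^ f * (1 + real d * (r - 1)) \<le> r ^ f * r ^ d"
    using assms by (intro mult_left_mono) auto
  then show ?thesis by (simp add: c power_add algebra_simps)
next
  case False
  then obtain d where f: "f = c + d" using le_Suc_ex nat_le_linear by blast
  \<comment> \<open>The claim to the left of \<open>f\<close>, with the common factor
    \<open>r ^ c\<close> removed.\<close>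
  have "r ^ d * (1 + (1 - r) * real d) \<le> 1"
  proof (induction d)
    case (Suc d)
    have "r ^ Suc d * (1 + (1 - r) * real (Suc d)) =
        r * (r ^ d * (1 + (1 - r) * real d)) + r ^ Suc d * (1 - r)"
      by (simp add: algebra_simps)
    also have "\<dots> \<le> r * 1 + 1 * (1 - r)"
      using assms by (intro add_mono mult_left_mono mult_right_mono Suc power_le_one) auto
    finally show ?case by simp
  qed simp
  then have "r ^ c * (r ^ d * (1 + (1 - r) * real d)) \<le> r ^ c * 1"
    using assms by (intro mult_left_mono) auto
  then show ?thesis by (simp add: f power_add algebra_simps)
qed

definition window_count :: "nat set \<Rightarrow> nat \<Rightarrow> nat \<Rightarrow> nat" where
  "window_count D m j = card (D \<inter> {j..<j + m})"

text \<open>Double counting of the pairs of a window and a drift in it.\<close>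

lemma sum_window_count:
  assumes "finite D"
  shows "(\<Sum>j=1..L. window_count D m j) = (\<Sum>x\<in>D. card {j\<in>{1..L}. j \<le> x \<and> x < j + m})"
proof -
  have "(\<Sum>j=1..L. window_count D m j) = (\<Sum>j=1..L. \<Sum>x\<in>D. if j \<le> x \<and> x < j + m then 1 else 0)"
    using assms
    by (intro sum.cong refl) (auto simp: window_count_def sum.If_cases intro!: arg_cong[where f = card])
  also have "\<dots> = (\<Sum>x\<in>D. \<Sum>j=1..L. if j \<le> x \<and> x < j + m then 1 else 0)"
    by (rule sum.swap)
  also have "\<dots> = (\<Sum>x\<in>D. card {j\<in>{1..L}. j \<le> x \<and> x < j + m})"
    by (intro sum.cong refl) (auto simp: sum.If_cases intro!: arg_cong[where f = card])
  finally show ?thesis .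
qed

lemma sum_window_count_le:
  assumes "finite D"
  shows "(\<Sum>j=1..L. window_count D m j) \<le> m * card D"
proof -
  have "card {j\<in>{1..L}. j \<le> x \<and> x < j + m} \<le> m" for x
  proof -
    have "card {j\<in>{1..L}. j \<le> x \<and> x < j + m} \<le> card {Suc x - m..<Suc x}"
      by (rule card_mono) auto
    then show ?thesis by simp
  qed
  then have "(\<Sum>x\<in>D. card {j\<in>{1..L}. j \<le> x \<and> x < j + m}) \<le> (\<Sum>x\<in>D. m)"
    by (intro sum_mono)
  then show ?thesis by (simp only: sum_window_count[OF assms] sum_constant mult.commute of_nat_id)
qed

text \<open>Only the drifts at distance less than \<open>m\<close> from an end lie in fewer than \<open>m\<close> windows.\<close>

lemma sum_window_count_ge:
  assumes D: "D \<subseteq> {1..N - 1}" and m: "m < N"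
  shows "m * card D \<le> (\<Sum>j=1..N - m. window_count D m j) + 2 * m\<^sup>2"
proof -
  \<comment> \<open>For \<open>x\<close> in this range all \<open>m\<close> possible window starts,
    \<open>Suc x - m\<close> to \<open>x\<close>, lie in \<open>{1..N - m}\<close>.\<close>
  define I where "I = D \<inter> {m..N - m}"
  have fin: "finite D" using D finite_subset by blast
  have full: "card {j\<in>{1..N - m}. j \<le> x \<and> x < j + m} = m" if "x \<in> I" for x
  proof -
    have "{j\<in>{1..N - m}. j \<le> x \<and> x < j + m} = {Suc x - m..<Suc x}"
      using that D m by (auto simp: I_def)
    then show ?thesis using that by (auto simp: I_def)
  qed
  have "D \<subseteq> I \<union> ({1..<m} \<union> {Suc (N - m)..N - 1})"
    using D by (auto simp: I_def)
  then have "card D \<le> card (I \<union> ({1..<m} \<union> {Suc (N - m)..N - 1}))"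
    by (rule card_mono[rotated]) (simp add: I_def)
  also have "\<dots> \<le> card I + (card {1..<m} + card {Suc (N - m)..N - 1})"
    by (rule order_trans[OF card_Un_le add_left_mono[OF card_Un_le]])
  also have "\<dots> \<le> card I + 2 * m"
    by auto
  finally have "m * card D \<le> m * (card I + 2 * m)"
    by simp
  also have "\<dots> = (\<Sum>x\<in>I. card {j\<in>{1..N - m}. j \<le> x \<and> x < j + m}) + 2 * m\<^sup>2"
    by (simp only: full cong: sum.cong) (simp add: power2_eq_square algebra_simps)
  also have "(\<Sum>x\<in>I. card {j\<in>{1..N - m}. j \<le> x \<and> x < j + m}) \<le>
      (\<Sum>x\<in>D. card {j\<in>{1..N - m}. j \<le> x \<and> x < j + m})"
    by (rule sum_mono2) (auto simp: I_def fin)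
  finally show ?thesis by (simp only: sum_window_count[OF fin])
qed

text \<open>Both sums are compared with the supporting line at \<open>f\<close>: for
  \<open>D'\<close> it is exact, as all counts are \<open>f\<close> or \<open>Suc f\<close>, and for
  \<open>D\<close> it is a lower bound. The two line sums differ by the slope \<open>s\<close>, at
  most 1, times the difference \<open>c - c'\<close> of the total counts. As \<open>D\<close> and
  \<open>D'\<close> have equal size, double counting bounds that difference by
  \<open>2 * m\<^sup>2\<close>.\<close>

lemma sum_power_window_count_le:
  fixes r :: real
  assumes r: "0 \<le> r" "r \<le> 1" and m: "m < N"
    and D: "D \<subseteq> {1..N - 1}" and D': "D' \<subseteq> {1..N - 1}" and card: "card D' = card D"
    and balanced: "\<And>j. 1 \<le> j \<Longrightarrow> j \<le> N - m \<Longrightarrow> window_count D' m j \<in> {f, Suc f}"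
  shows "(\<Sum>j=1..N - m. r ^ window_count D' m j) \<le> (\<Sum>j=1..N - m. r ^ window_count D m j) + 2 * real m ^ 2"
proof -
  define s where "s = r ^ f - r ^ Suc f"
  define c where "c = (\<Sum>j=1..N - m. real (window_count D m j))"
  define c' where "c' = (\<Sum>j=1..N - m. real (window_count D' m j))"
  have "r ^ f \<le> 1" "r ^ f * r \<le> r ^ f" "0 \<le> r ^ f * r"
    using r by (auto simp: power_le_one mult_left_le)
  then have s: "0 \<le> s" "s \<le> 1"
    by (auto simp: s_def mult.commute)
  have line: "(\<Sum>j=1..L. r ^ f - s * (g j - real f)) = real L * (r ^ f + s * real f) - s * (\<Sum>j=1..L. g j)"
    for L :: nat and g :: "nat \<Rightarrow> real"
    by (simp add: right_diff_distrib sum_subtractf sum_distrib_left) (simp add: algebra_simps)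
  have fin: "finite D" using D finite_subset by blast
  have "real (m * card D') \<le> real ((\<Sum>j=1..N - m. window_count D' m j) + 2 * m\<^sup>2)"
    using sum_window_count_ge[OF D' m] of_nat_le_iff by blast
  moreover have "real (\<Sum>j=1..N - m. window_count D m j) \<le> real (m * card D)"
    using sum_window_count_le[OF fin] of_nat_le_iff by blast
  ultimately have "c - c' \<le> 2 * real m ^ 2"
    by (simp add: c_def c'_def card)
  then have "s * (c - c') \<le> 1 * (2 * real m ^ 2)"
    by (rule order_trans[OF mult_left_mono[OF _ s(1)] mult_right_mono[OF s(2)]]) simp
  moreover have "(\<Sum>j=1..N - m. r ^ window_count D' m j) = (\<Sum>j=1..N - m. r ^ f - s * (real (window_count D' m j) - real f))"
  proof (intro sum.cong refl)
    fix j assume "j \<in> {1..N - m}"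
    then show "r ^ window_count D' m j = r ^ f - s * (real (window_count D' m j) - real f)"
      using balanced[of j] by (auto simp: s_def)
  qed
  moreover have "\<dots> = real (N - m) * (r ^ f + s * real f) - s * c'"
    unfolding c'_def by (rule line)
  moreover have "(\<Sum>j=1..N - m. r ^ f - s * (real (window_count D m j) - real f)) \<le> (\<Sum>j=1..N - m. r ^ window_count D m j)"
    unfolding s_def using r by (intro sum_mono power_ge_supporting_line)
  moreover have "(\<Sum>j=1..N - m. r ^ f - s * (real (window_count D m j) - real f)) = real (N - m) * (r ^ f + s * real f) - s * c"
    unfolding c_def by (rule line)
  ultimately show ?thesis by (simp add: algebra_simps)
qed


section \<open>The expected hitting time as a sum over windows\<close>

text \<open>Let \<open>\<rho>\<close> be the ratio at \<open>Suc l\<close>. Passing to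
  \<open>Suc l\<close> multiplies every old product by \<open>\<rho>\<close> and adds the one-point
  interval. The factor 2 arises because \<open>\<rho>\<close> enters twice: from
  \<open>1 / \<omega> = 1 + \<rho>\<close> and from \<open>\<rho>\<close> times the leading 1 of the
  previous crossing time.\<close>

lemma crossing_time_eq_sum_prod:
  assumes "\<And>i. 1 \<le> i \<Longrightarrow> i \<le> l \<Longrightarrow> \<omega> i \<noteq> 0"
  shows "crossing_time \<omega> l = 1 + 2 * (\<Sum>j=1..l. \<Prod>x\<in>{j..l}. (1 - \<omega> x) / \<omega> x)"
  using assms
proof (induction l)
  case (Suc l)
  have "(\<Sum>j=1..Suc l. \<Prod>x\<in>{j..Suc l}. (1 - \<omega> x) / \<omega> x) =
      (\<Sum>j=1..l. \<Prod>x\<in>{j..Suc l}. (1 - \<omega> x) / \<omega> x) + (1 - \<omega> (Suc l)) / \<omega> (Suc l)"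
    by simp
  also have "(\<Sum>j=1..l. \<Prod>x\<in>{j..Suc l}. (1 - \<omega> x) / \<omega> x) =
      (\<Sum>j=1..l. (1 - \<omega> (Suc l)) / \<omega> (Suc l) * (\<Prod>x\<in>{j..l}. (1 - \<omega> x) / \<omega> x))"
    by (intro sum.cong refl) (simp add: atLeastAtMostSuc_conv)
  also have "\<dots> = (1 - \<omega> (Suc l)) / \<omega> (Suc l) * (\<Sum>j=1..l. \<Prod>x\<in>{j..l}. (1 - \<omega> x) / \<omega> x)"
    by (simp only: sum_distrib_left)
  finally have "(\<Sum>j=1..Suc l. \<Prod>x\<in>{j..Suc l}. (1 - \<omega> x) / \<omega> x) =
      (1 - \<omega> (Suc l)) / \<omega> (Suc l) * (\<Sum>j=1..l. \<Prod>x\<in>{j..l}. (1 - \<omega> x) / \<omega> x) + (1 - \<omega> (Suc l)) / \<omega> (Suc l)" .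
  moreover have "1 / \<omega> (Suc l) = 1 + (1 - \<omega> (Suc l)) / \<omega> (Suc l)"
    using Suc.prems[of "Suc l"] by (simp add: field_simps)
  ultimately show ?case
    using Suc by (simp only: crossing_time.simps) (simp add: algebra_simps)
qed simp

lemma sum_intervals_by_length:
  fixes F :: "nat set \<Rightarrow> 'a :: comm_monoid_add"
  shows "(\<Sum>l<N. \<Sum>j=1..l. F {j..l}) = (\<Sum>m=1..<N. \<Sum>j=1..N - m. F {j..<j + m})"
proof -
  have "(\<Sum>l<N. \<Sum>j=1..l. F {j..l}) = (\<Sum>(l, j)\<in>(SIGMA l:{..<N}. {1..l}). F {j..l})"
    by (simp add: sum.Sigma)
  also have "\<dots> = (\<Sum>(m, j)\<in>(SIGMA m:{1..<N}. {1..N - m}). F {j..<j + m})"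
    by (rule sum.reindex_bij_witness[where i = "\<lambda>(m, j). (j + m - 1, j)" and j = "\<lambda>(l, j). (Suc l - j, j)"])
      (auto simp: atLeastLessThanSuc_atLeastAtMost)
  also have "\<dots> = (\<Sum>m=1..<N. \<Sum>j=1..N - m. F {j..<j + m})"
    by (simp add: sum.Sigma)
  finally show ?thesis .
qed

text \<open>The ratio is \<open>b * r\<close> at a drift and \<open>b\<close> elsewhere, so the
  product over a window depends only on its length and its number of drifts.\<close>

lemma expected_hitting_time_two_valued:
  fixes p q :: real
  defines "b \<equiv> (1 - q) / q"
  defines "r \<equiv> ((1 - p) / p) / b"
  assumes N: "N > 0" and pq: "0 < q" "q < 1" "0 < p" "p \<le> 1"
    and \<omega>: "\<And>i. 1 \<le> i \<Longrightarrow> i < N \<Longrightarrow> \<omega> i \<in> {p, q}"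
    and D: "D = {i\<in>{1..N - 1}. \<omega> i = p}"
  shows "expected_hitting_time N \<omega> 0 =
    ereal (real N + 2 * (\<Sum>m=1..<N. b ^ m * (\<Sum>j=1..N - m. r ^ window_count D m j)))"
proof -
  have b: "b > 0" using pq by (simp add: b_def)
  have w: "0 < \<omega> i \<and> \<omega> i \<le> 1" if "1 \<le> i" "i < N" for i
    using \<omega>[OF that] pq by auto
  have prod: "(\<Prod>x\<in>{j..<j + m}. (1 - \<omega> x) / \<omega> x) = b ^ m * r ^ window_count D m j"
    if "j \<in> {1..N - m}" "m \<in> {1..<N}" for j m
  proof -
    have "(\<Prod>x\<in>{j..<j + m}. (1 - \<omega> x) / \<omega> x) = (\<Prod>x\<in>{j..<j + m}. b * (if x \<in> D then r else 1))"
    proof (intro prod.cong refl)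
      fix x assume "x \<in> {j..<j + m}"
      then have "1 \<le> x" "x < N" using that by auto
      then show "(1 - \<omega> x) / \<omega> x = b * (if x \<in> D then r else 1)"
        using \<omega>[of x] b by (auto simp: D r_def) (auto simp: b_def)
    qed
    also have "\<dots> = b ^ m * r ^ window_count D m j"
      by (simp add: prod.distrib prod.If_cases window_count_def Int_commute)
    finally show ?thesis .
  qed
  have "(\<Sum>l<N. crossing_time \<omega> l) = (\<Sum>l<N. 1 + 2 * (\<Sum>j=1..l. \<Prod>x\<in>{j..l}. (1 - \<omega> x) / \<omega> x))"
    using w by (intro sum.cong refl crossing_time_eq_sum_prod) fastforce
  also have "\<dots> = real N + 2 * (\<Sum>l<N. \<Sum>j=1..l. \<Prod>x\<in>{j..l}. (1 - \<omega> x) / \<omega> x)"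
    by (simp add: sum.distrib sum_distrib_left)
  also have "(\<Sum>l<N. \<Sum>j=1..l. \<Prod>x\<in>{j..l}. (1 - \<omega> x) / \<omega> x) =
      (\<Sum>m=1..<N. \<Sum>j=1..N - m. \<Prod>x\<in>{j..<j + m}. (1 - \<omega> x) / \<omega> x)"
    by (rule sum_intervals_by_length)
  also have "\<dots> = (\<Sum>m=1..<N. b ^ m * (\<Sum>j=1..N - m. r ^ window_count D m j))"
    unfolding sum_distrib_left by (intro sum.cong refl prod)
  finally show ?thesis
    using expected_hitting_time_eq_sum_crossing_time[OF N w] by simp
qed

section \<open>Window counts of the equally spaced environment\<close>

text \<open>The \<open>i\<close>-th drift lies in \<open>{j..<j + m}\<close> iff \<open>j \<le> i * \<alpha> < j + m\<close> with \<open>\<alpha> = (N - 1) / k\<close>,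
  so the drifts in a window are indexed by an interval of integers.\<close>

lemma window_count_equally_spaced:
  fixes N k m j :: nat
  assumes "p \<noteq> q" and k: "1 \<le> k" "k \<le> N - 1" and jm: "1 \<le> j" "j + m \<le> N"
  defines "\<alpha> \<equiv> (real N - 1) / real k"
  shows "int (window_count {x\<in>{1..N - 1}. equally_spaced_env p q N k x = p} m j) =
    \<lceil>real (j + m) / \<alpha>\<rceil> - \<lceil>real j / \<alpha>\<rceil>"
proof -
  define A where "A = {\<lceil>real j / \<alpha>\<rceil>..<\<lceil>real (j + m) / \<alpha>\<rceil>}"
  define g where "g i = nat \<lfloor>real_of_int i * \<alpha>\<rfloor>" for i
  have \<alpha>: "1 \<le> \<alpha>"
    using k by (simp add: \<alpha>_def of_nat_diff le_diff_eq field_simps)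
  have A: "i \<in> A \<longleftrightarrow> real j \<le> real_of_int i * \<alpha> \<and> real_of_int i * \<alpha> < real (j + m)" for i
    using \<alpha> by (simp add: A_def ceiling_le_iff less_ceiling_iff divide_le_eq less_divide_eq)
  \<comment> \<open>The bounds on the drift index come for free: \<open>j \<ge> 1\<close> forces
    \<open>i \<ge> 1\<close>, and an index above \<open>k\<close> would give
    \<open>i * \<alpha> \<ge> N - 1 + \<alpha> \<ge> N\<close>, beyond the window.\<close>
  have A_range: "1 \<le> i \<and> i \<le> int k" if "i \<in> A" for i
  proof
    have "0 < real_of_int i * \<alpha>" using that A jm by fastforce
    then show "1 \<le> i" using \<alpha> by (simp add: zero_less_mult_iff)
    show "i \<le> int k"
    proof (rule ccontr)
      assume "\<not> i \<le> int k"
      then have "(real k + 1) * \<alpha> \<le> real_of_int i * \<alpha>"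
        using \<alpha> by (intro mult_right_mono) linarith+
      moreover have "real k * \<alpha> = real N - 1" using k by (simp add: \<alpha>_def)
      ultimately have "real N \<le> real_of_int i * \<alpha>" using \<alpha> by (simp add: algebra_simps)
      with that jm show False unfolding A by linarith
    qed
  qed
  \<comment> \<open>Consecutive multiples of \<open>\<alpha>\<close> are at least 1 apart, so their
    floors are distinct.\<close>
  have "inj_on g A"
  proof (rule strict_mono_on_imp_inj_on[OF strict_mono_onI])
    fix i i' assume i: "i \<in> A" "i' \<in> A" "i < i'"
    have "real_of_int i * \<alpha> + \<alpha> \<le> real_of_int i' * \<alpha>"
      using i \<alpha> mult_right_mono[of "real_of_int i + 1" "real_of_int i'" \<alpha>] by (simp add: algebra_simps)
    moreover have "0 \<le> real_of_int i * \<alpha>" using A_range[OF i(1)] \<alpha> by simp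
    ultimately show "g i < g i'" using \<alpha> by (simp add: g_def zless_nat_conj) linarith
  qed
  moreover have "{x\<in>{1..N - 1}. equally_spaced_env p q N k x = p} \<inter> {j..<j + m} = g ` A"
  proof (intro set_eqI iffI)
    fix x assume "x \<in> {x\<in>{1..N - 1}. equally_spaced_env p q N k x = p} \<inter> {j..<j + m}"
    then obtain i where x: "j \<le> x" "x < j + m" and i: "int x = \<lfloor>real i * \<alpha>\<rfloor>"
      using \<open>p \<noteq> q\<close> by (auto simp: equally_spaced_env_def \<alpha>_def split: if_splits)
    have "real j \<le> real i * \<alpha>" "real i * \<alpha> < real (j + m)"
      using x i by linarith+
    then have "int i \<in> A" by (simp add: A)
    moreover have "x = g (int i)" using i[symmetric] by (simp add: g_def)
    ultimately show "x \<in> g ` A" by blast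
  next
    fix x assume "x \<in> g ` A"
    then obtain i where i: "i \<in> A" "x = g i" by blast
    note range = A_range[OF i(1)] and bounds = i(1)[unfolded A]
    have x: "int x = \<lfloor>real (nat i) * \<alpha>\<rfloor>"
      using range \<alpha> by (simp add: i(2) g_def)
    have "real (nat i) * \<alpha> = real_of_int i * \<alpha>" using range by simp
    then have "j \<le> x" "x < j + m"
      using x bounds by linarith+
    moreover have "nat i \<in> {1..k}" using range by auto
    ultimately show "x \<in> {x\<in>{1..N - 1}. equally_spaced_env p q N k x = p} \<inter> {j..<j + m}"
      using x jm by (auto simp: equally_spaced_env_def \<alpha>_def)
  qed
  ultimately have "window_count {x\<in>{1..N - 1}. equally_spaced_env p q N k x = p} m j = card A"
    by (simp add: window_count_def card_image)
  moreover have "\<lceil>real j / \<alpha>\<rceil> \<le> \<lceil>real (j + m) / \<alpha>\<rceil>"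
    using \<alpha> by (intro ceiling_mono divide_right_mono) auto
  ultimately show ?thesis by (simp add: A_def)
qed

text \<open>The whole interior is the window with start 1 and length \<open>N - 1\<close>. Since
  \<open>N / \<alpha> = k + 1 / \<alpha>\<close>, the two ceilings of the window formula differ by
  exactly \<open>k\<close>.\<close>

lemma card_equally_spaced:
  assumes "p \<noteq> q" and k: "k \<le> N - 1"
  shows "card {x\<in>{1..N - 1}. equally_spaced_env p q N k x = p} = k"
proof (cases "k = 0")
  case True
  then show ?thesis using assms by (simp add: equally_spaced_env_def)
next
  case False
  define D where "D = {x\<in>{1..N - 1}. equally_spaced_env p q N k x = p}"
  define \<alpha> where "\<alpha> = (real N - 1) / real k"
  have N: "1 + (N - 1) = N" "real N - 1 > 0" using k False by auto
  have "D \<inter> {1..<1 + (N - 1)} = D" by (auto simp: D_def)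
  then have "int (card D) = int (window_count D (N - 1) 1)"
    by (simp only: window_count_def)
  also have "\<dots> = \<lceil>real (1 + (N - 1)) / \<alpha>\<rceil> - \<lceil>real 1 / \<alpha>\<rceil>"
    using False k N unfolding D_def \<alpha>_def by (intro window_count_equally_spaced) (use assms in auto)
  also have "real (1 + (N - 1)) / \<alpha> = real k + 1 / \<alpha>"
    using N False by (simp add: N \<alpha>_def field_simps)
  also have "\<lceil>real k + 1 / \<alpha>\<rceil> - \<lceil>real 1 / \<alpha>\<rceil> = int k"
    by simp linarith
  finally show ?thesis by (simp add: D_def)
qed

text \<open>For reals \<open>x\<close> and \<open>y\<close>, the ceiling of \<open>x + y\<close>
  exceeds that of \<open>x\<close> by the floor of \<open>y\<close> or by one more. Here
  \<open>y = m / \<alpha>\<close> does not depend on the start \<open>j\<close>.\<close>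

lemma window_count_equally_spaced_balanced:
  assumes "p \<noteq> q" and k: "k \<le> N - 1"
  shows "\<exists>f. \<forall>j. 1 \<le> j \<longrightarrow> j + m \<le> N \<longrightarrow>
    window_count {x\<in>{1..N - 1}. equally_spaced_env p q N k x = p} m j \<in> {f, Suc f}"
proof (cases "k = 0")
  case True
  then show ?thesis using assms by (auto simp: equally_spaced_env_def window_count_def)
next
  case False
  define \<alpha> where "\<alpha> = (real N - 1) / real k"
  have \<alpha>: "\<alpha> \<ge> 0" using k False by (simp add: \<alpha>_def)
  define f where "f = nat \<lfloor>real m / \<alpha>\<rfloor>"
  have f: "int f = \<lfloor>real m / \<alpha>\<rfloor>" using \<alpha> by (simp add: f_def)
  show ?thesis
  proof (intro exI allI impI)
    fix j assume j: "1 \<le> j" "j + m \<le> N"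
    have "\<lceil>real j / \<alpha> + real m / \<alpha>\<rceil> - \<lceil>real j / \<alpha>\<rceil> \<in> {int f, int f + 1}"
      unfolding f by simp linarith
    then show "window_count {x\<in>{1..N - 1}. equally_spaced_env p q N k x = p} m j \<in> {f, Suc f}"
      using window_count_equally_spaced[OF assms(1) _ k j] False
      by (auto simp: \<alpha>_def[symmetric] add_divide_distrib)
  qed
qed

section \<open>Comparison of the two expected hitting times\<close>

theorem theorem3:
  fixes p q \<epsilon> :: real
  assumes "1/2 < q" and "q < p" and "p \<le> 1" and "\<epsilon> > 0"
  shows "\<exists>n0::nat. \<forall>N>n0. \<forall>\<omega> \<in> {1..N-1} \<rightarrow> {p, q}.
    (let k = card {i \<in> {1..N-1}. \<omega> i = p} in
      expected_hitting_time N \<omega> 0 / ereal (real N) >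
      expected_hitting_time N (equally_spaced_env p q N k) 0 / ereal (real N) - ereal \<epsilon>)"
proof -
  define b where "b = (1 - q) / q"
  define r where "r = ((1 - p) / p) / b"
  have b: "0 < b" "b < 1" using assms by (auto simp: b_def field_simps)
  \<comment> \<open>The map \<open>x \<mapsto> (1 - x) / x\<close> is decreasing on positive reals,
    so \<open>q < p\<close> yields \<open>r \<le> 1\<close>.\<close>
  have "0 \<le> (1 - p) / p" "(1 - p) / p \<le> b" using assms by (auto simp: b_def field_simps)
  then have r: "0 \<le> r" "r \<le> 1"
    using b unfolding r_def by (metis divide_nonneg_pos, metis divide_le_eq_1_pos)
  have pq: "0 < q" "q < 1" "0 < p" "p \<le> 1" "p \<noteq> q" using assms by auto
  have "summable (\<lambda>m. b ^ m * (2 * real m ^ 2))"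
  proof (rule summable_comparison_test_bigo)
    show "summable (\<lambda>m. norm (inverse (real m ^ 2)))"
      using inverse_power_summable[of 2, where 'a = real] by simp
    show "(\<lambda>m. b ^ m * (2 * real m ^ 2)) \<in> O(\<lambda>m. inverse (real m ^ 2))"
      using b by real_asymp
  qed
  \<comment> \<open>\<open>C\<close> depends on \<open>q\<close> alone and will bound the excess of
    the window sum for equal spacing, whatever \<open>N\<close> and the environment. The hitting
    time contains the window sum twice, whence the threshold \<open>2 * C / \<epsilon>\<close> for
    \<open>N\<close>.\<close>
  define C where "C = (\<Sum>m. b ^ m * (2 * real m ^ 2))"
  have bound: "expected_hitting_time N (equally_spaced_env p q N k) 0 / ereal (real N) - ereal \<epsilon>
      < expected_hitting_time N \<omega> 0 / ereal (real N)"
    if N: "N > nat \<lceil>2 * C / \<epsilon>\<rceil>" and \<omega>: "\<omega> \<in> {1..N-1} \<rightarrow> {p, q}"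
      and k: "k = card {i \<in> {1..N-1}. \<omega> i = p}" for N k and \<omega> :: "nat \<Rightarrow> real"
  proof -
    have N0: "N > 0" using N by simp
    define D where "D = {i \<in> {1..N-1}. \<omega> i = p}"
    define D' where "D' = {i \<in> {1..N-1}. equally_spaced_env p q N k i = p}"
    define S where "S E = (\<Sum>m=1..<N. b ^ m * (\<Sum>j=1..N - m. r ^ window_count E m j))" for E
    have "card D \<le> card {1..N - 1}"
      by (rule card_mono) (auto simp: D_def)
    then have kN: "k \<le> N - 1" by (simp add: k D_def)
    have E: "expected_hitting_time N \<omega> 0 = ereal (real N + 2 * S D)"
      unfolding S_def r_def b_def
      by (rule expected_hitting_time_two_valued[OF N0 pq(1-4) _ D_def], rule Pi_mem[OF \<omega>]) auto
    have E': "expected_hitting_time N (equally_spaced_env p q N k) 0 = ereal (real N + 2 * S D')"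
      unfolding S_def r_def b_def
      by (rule expected_hitting_time_two_valued[OF N0 pq(1-4) _ D'_def])
        (auto simp: equally_spaced_env_def)
    have "S D' \<le> (\<Sum>m=1..<N. b ^ m * ((\<Sum>j=1..N - m. r ^ window_count D m j) + 2 * real m ^ 2))"
      unfolding S_def
    proof (intro sum_mono mult_left_mono)
      fix m assume m: "m \<in> {1..<N}"
      obtain f where f: "\<And>j. 1 \<le> j \<Longrightarrow> j + m \<le> N \<Longrightarrow> window_count D' m j \<in> {f, Suc f}"
        using window_count_equally_spaced_balanced[OF pq(5) kN] unfolding D'_def by blast
      have "card D' = card D"
        using card_equally_spaced[OF pq(5) kN] by (simp add: D'_def D_def k)
      then show "(\<Sum>j=1..N - m. r ^ window_count D' m j) \<le> (\<Sum>j=1..N - m. r ^ window_count D m j) + 2 * real m ^ 2"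
        using m f by (intro sum_power_window_count_le[OF r, where f = f]) (auto simp: D_def D'_def)
    qed (use b in auto)
    also have "\<dots> = S D + (\<Sum>m=1..<N. b ^ m * (2 * real m ^ 2))"
      by (simp only: S_def distrib_left sum.distrib)
    also have "(\<Sum>m=1..<N. b ^ m * (2 * real m ^ 2)) \<le> C"
      unfolding C_def using b by (intro sum_le_suminf \<open>summable _\<close>) auto
    finally have S: "S D' \<le> S D + C" by simp
    have "2 * C / \<epsilon> < real N" using N by linarith
    then have "2 * C < \<epsilon> * real N" using assms by (simp add: field_simps)
    with S have "real N + 2 * S D' - \<epsilon> * real N < real N + 2 * S D" by simp
    then have "(real N + 2 * S D' - \<epsilon> * real N) / real N < (real N + 2 * S D) / real N"
      using N0 by (intro divide_strict_right_mono) auto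
    then have "(real N + 2 * S D') / real N - \<epsilon> < (real N + 2 * S D) / real N"
      using N0 by (simp add: diff_divide_distrib)
    then show ?thesis using N0 by (simp add: E E')
  qed
  then show ?thesis
    unfolding Let_def by blast
qed

end
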